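(* Let $f,g$ be smooth vector fields on $\mathbb{R}^n$ and assume that the system $(f,g)$, i.e. $\dot x=f(x)+u\,g(x)$, admits a super-linearization. Then $(f,g)$ admits a super-linearization in reduced visible form. Furthermore, let $\mathcal{L}$ be any super-linearization of $(f,g)$ in reduced visible form, and let $m_v^*$ be the rank of its $G$-matrix. Then the least value of the number of visible observables amongst all super-linearizations of $(f,g)$ is $m_v^*$.
   Context: $(f,g)$ denotes the control system $\dot x=f(x)+u\,g(x)$, $x\in\mathbb{R}^n$, with scalar control $u$; $e^{t(f+ug)}x_0$ denotes its solution at time $t$ with initial state $x_0$ and control $u(t)$. Similarly, for $A_\ell\in\mathbb{R}^{(n+m)\times(n+m)}$ and $B_\ell,D_\ell\in\mathbb{R}^{n+m}$, $e^{t(A_\ell z+B_\ell u+D_\ell)}z_0$ denotes the solution at time $t$ of the affine control system $\dot z=A_\ell z+B_\ell u+D_\ell$ with $z(0)=z_0$. $\Pi:\mathbb{R}^{n+m}\to\mathbb{R}^n$ is the projection onto the first $n$ coordinates. Super-linearization: $(f,g)$ is super-linearized to $(A_\ell,B_\ell,D_\ell)$ with observables $p$ (equivalently, via $p$), where $m\ge 0$ and $p:\mathbb{R}^n\to\mathbb{R}^m$ is a smooth map, if for all $x_0\in\mathbb{R}^n$ and every control $u(t)$, $$\Pi\left(e^{t(A_\ell z+B_\ell u+D_\ell)}z_0\right)=e^{t(f+ug)}x_0,\qquad z_0=(x_0,p(x_0)),$$ as long as the solutions exist. The data $\mathcal{L}=(A_\ell,B_\ell,D_\ell,p)$ is called a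 super-linearization of $(f,g)$, and the components $p_1,\dots,p_m:\mathbb{R}^n\to\mathbb{R}$ are its observables. The integer $m$ may differ from one super-linearization to another. Block partition and $G$-matrix: write $A_\ell=\begin{bmatrix}A&G\\H&M\end{bmatrix}$ with $A\in\mathbb{R}^{n\times n}$, $G\in\mathbb{R}^{n\times m}$, $H\in\mathbb{R}^{m\times n}$, $M\in\mathbb{R}^{m\times m}$. The matrix $G$ is the $G$-matrix of the super-linearization. Visible observables: $p_j$ is a visible observable of the super-linearization if there is $i\in\{1,\dots,n\}$ with $G_{ij}\neq0$; otherwise it is a hidden observable. Reduced visible form: the super-linearization is in reduced visible form if $p$ has no constant term ($p(0)=0$) and no linear term ($\frac{\partial p}{\partial x}(0)=0$), and its visible observables are linearly independent functions (i.e. no nontrivial constant-coefficient linear combination of them vanishes identically on $\mathbb{R}^n$). *)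

theory Defs
  imports "HOL-Analysis.Analysis"
begin

fun k_smooth :: "nat \<Rightarrow> ('a::euclidean_space \<Rightarrow> 'b::real_normed_vector) \<Rightarrow> bool" where
  "k_smooth 0 h \<longleftrightarrow> continuous_on UNIV h"
| "k_smooth (Suc k) h \<longleftrightarrow>
     (\<forall>x. h differentiable (at x)) \<and>
     (\<forall>v. k_smooth k (\<lambda>x. frechet_derivative h (at x) v))"

definition smooth :: "('a::euclidean_space \<Rightarrow> 'b::real_normed_vector) \<Rightarrow> bool" where
  "smooth h \<longleftrightarrow> (\<forall>k. k_smooth k h)"

text \<open>
  Controls are the locally (Lebesgue) integrable functions of time, and solutions are
  Caratheodory solutions, i.e. solutions of the integral equation. For such controls the
  gauge integral below coincides with the Lebesgue integral, and every solution
  is absolutely continuous and satisfies the differential equation almost everywhere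
  (everywhere, if the control is continuous).
\<close>

definition control :: "(real \<Rightarrow> real) \<Rightarrow> bool" where
  "control u \<longleftrightarrow> (\<forall>T. u absolutely_integrable_on {0..T})"

text \<open>\<open>control_solution f g u x\<^sub>0 T x\<close>: \<open>x\<close> solves
  \<open>x' = f x + u g x\<close> with \<open>x 0 = x\<^sub>0\<close> on the time interval \<open>[0, T]\<close>.\<close>

definition control_solution ::
  "(real^'n \<Rightarrow> real^'n) \<Rightarrow> (real^'n \<Rightarrow> real^'n) \<Rightarrow> (real \<Rightarrow> real) \<Rightarrow>
   real^'n \<Rightarrow> real \<Rightarrow> (real \<Rightarrow> real^'n) \<Rightarrow> bool" where
  "control_solution f g u x\<^sub>0 T x \<longleftrightarrow>
     (\<forall>t\<in>{0..T}. ((\<lambda>s. f (x s) + u s *\<^sub>R g (x s)) has_integral (x t - x\<^sub>0)) {0..t})"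

text \<open>
  The number \<open>m\<close> of observables varies from one super-linearization to another, so it is a
  natural number rather than a type. The space of dimension \<open>n + m\<close> has coordinates indexed by
  \<open>UNIV <+> {..<m}\<close>: \<open>Inl i\<close> stands for the \<open>i\<close>-th of the first \<open>n\<close> coordinates, \<open>Inr j\<close>
  (\<open>j < m\<close>) for the \<open>j\<close>-th of the last \<open>m\<close> ones. Entries at indices outside this set are
  irrelevant.
\<close>

definition coords :: "nat \<Rightarrow> ('n::finite + nat) set" where
  "coords m = UNIV <+> {..<m}"

record 'n slin =
  obs_dim :: nat
  sys_A :: "('n::finite + nat) \<Rightarrow> ('n + nat) \<Rightarrow> real"
  sys_B :: "('n + nat) \<Rightarrow> real"
  sys_D :: "('n + nat) \<Rightarrow> real"
  obs :: "nat \<Rightarrow> real^'n \<Rightarrow> real"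

definition affine_solution ::
  "'n::finite slin \<Rightarrow> (real \<Rightarrow> real) \<Rightarrow> ('n + nat \<Rightarrow> real) \<Rightarrow> real \<Rightarrow>
   (real \<Rightarrow> 'n + nat \<Rightarrow> real) \<Rightarrow> bool" where
  "affine_solution L u z\<^sub>0 T z \<longleftrightarrow>
     (\<forall>t\<in>{0..T}. \<forall>a\<in>coords (obs_dim L).
        ((\<lambda>s. (\<Sum>b\<in>coords (obs_dim L). sys_A L a b * z s b) + sys_B L a * u s + sys_D L a)
          has_integral (z t a - z\<^sub>0 a)) {0..t})"

definition proj :: "('n::finite + nat \<Rightarrow> real) \<Rightarrow> real^'n" where
  "proj z = (\<chi> i. z (Inl i))"

definition lift_state :: "'n::finite slin \<Rightarrow> real^'n \<Rightarrow> ('n + nat \<Rightarrow> real)" where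
  "lift_state L x = case_sum (\<lambda>i. x $ i) (\<lambda>j. obs L j x)"

definition super_linearization ::
  "(real^'n \<Rightarrow> real^'n) \<Rightarrow> (real^'n \<Rightarrow> real^'n) \<Rightarrow> 'n::finite slin \<Rightarrow> bool" where
  "super_linearization f g L \<longleftrightarrow>
     (\<forall>j<obs_dim L. smooth (obs L j)) \<and>
     (\<forall>x\<^sub>0 u T x z. control u \<and> T \<ge> 0 \<and> control_solution f g u x\<^sub>0 T x \<and>
        affine_solution L u (lift_state L x\<^sub>0) T z \<longrightarrow>
        (\<forall>t\<in>{0..T}. proj (z t) = x t))"

definition G_matrix :: "'n::finite slin \<Rightarrow> 'n \<Rightarrow> nat \<Rightarrow> real" where
  "G_matrix L i j = sys_A L (Inl i) (Inr j)"

text \<open>The rank of the \<open>n \<times> m\<close> matrix \<open>G\<close>, as the dimension of its column space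
  (cf. \<open>column_rank_def\<close> for matrices of type-indexed dimensions).\<close>

definition G_rank :: "'n::finite slin \<Rightarrow> nat" where
  "G_rank L = dim ((\<lambda>j. (\<chi> i. G_matrix L i j) :: real^'n) ` {..<obs_dim L})"

definition visible :: "'n::finite slin \<Rightarrow> nat set" where
  "visible L = {j. j < obs_dim L \<and> (\<exists>i. G_matrix L i j \<noteq> 0)}"

text \<open>Linear independence is that of the family of visible observables, indexed by \<open>j\<close>; in
  particular repeated visible observables count as dependent.\<close>

definition reduced_visible_form :: "'n::finite slin \<Rightarrow> bool" where
  "reduced_visible_form L \<longleftrightarrow>
     (\<forall>j<obs_dim L. obs L j 0 = 0 \<and> (obs L j has_derivative (\<lambda>_. 0)) (at 0)) \<and>
     (\<forall>c :: nat \<Rightarrow> real.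
        (\<forall>x. (\<Sum>j\<in>visible L. c j * obs L j x) = 0) \<longrightarrow> (\<forall>j\<in>visible L. c j = 0))"

end

theory Submission
  imports Defs
begin

text \<open>
  Write \<open>(A, G)\<close> for the first \<open>n\<close> rows of \<open>A\<^sub>l\<close>, and \<open>B\<^sub>1\<close>, \<open>D\<^sub>1\<close> for the first \<open>n\<close> entries of
  \<open>B\<^sub>l\<close>, \<open>D\<^sub>l\<close>. Comparing the two systems at time \<open>0\<close> under constant controls shows that every
  super-linearization satisfies \<open>f x = A x + G p(x) + D\<^sub>1\<close> and \<open>g x = B\<^sub>1\<close>
  (\<open>super_linearization_vector_fields\<close>). The comparison needs that both systems do have solutions
  for a short time; they come from the Picard theorem \<open>picard_global\<close>, applied to \<open>f + c g\<close> after
  cutting it off outside a ball and to the affine system.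

  The invariant behind the theorem is the nonlinear part \<open>N x = f x - f 0 - f'(0) x\<close>, which depends
  on \<open>f\<close> only. In every super-linearization \<open>N x = \<Sum>\<^sub>j (p\<^sub>j x - p\<^sub>j 0 - p\<^sub>j'(0) x) G\<^sub>j\<close>, where \<open>G\<^sub>j\<close> is
  the \<open>j\<close>-th column of \<open>G\<close> (\<open>nonlinear_part_eq\<close>). Hence the range of \<open>N\<close> lies in the column space
  of \<open>G\<close>, which is spanned by the nonzero columns, and those belong to the visible observables: there
  are at least \<open>dim (range N)\<close> of them (\<open>visible_lower_bound\<close>). In reduced visible form
  \<open>N x = \<Sum>\<^sub>j p\<^sub>j x G\<^sub>j\<close> with independent visible \<open>p\<^sub>j\<close>, so a vector orthogonal to the range of \<open>N\<close> is
  orthogonal to all columns, and the rank of \<open>G\<close> equals \<open>dim (range N)\<close> (\<open>G_rank_reduced\<close>).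

  The bound is attained by a super-linearization in reduced visible form, built from any given one
  in two steps. A shear of the state space, \<open>y \<mapsto> y - p(0) - p'(0) x\<close>, removes the affine parts of
  the observables. Then, with an orthonormal basis \<open>b\<^sub>1, \<dots>, b\<^sub>r\<close> of the span of the range of \<open>N\<close>, the
  functions \<open>x \<mapsto> b\<^sub>k \<bullet> N x\<close> are adjoined as new observables. They are linearly independent, and
  they alone feed the first \<open>n\<close> coordinates, through the columns \<open>b\<^sub>k\<close>; all the old observables become
  hidden. This changes the affine vector field off the set where \<open>G y\<close> lies in the span of the range
  of \<open>N\<close>, but a solution that follows the control system stays in that set, because
  \<open>G y = N x\<close> along it. So the solution of the old affine system yields a solution of the new one, and
  uniqueness for the new one (\<open>affine_solution_unique\<close>) finishes the argument.
\<close>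

section \<open>Integral equations\<close>

instance bcontfun :: (metric_space, banach) banach ..

text \<open>
  Picard iteration on a whole interval of prescribed length, without gluing short pieces: the unknown is
  rescaled to \<open>\<psi> s = exp (- c s) x s\<close> with \<open>c > 2 K\<close>, and for \<open>\<psi>\<close> the integral operator is a
  contraction of the space of bounded continuous functions, since
  \<open>exp (- c t) * (integral of K exp (c s) over [0, t]) \<le> K / c\<close>.
\<close>

lemma picard_global:
  fixes F :: "real \<Rightarrow> 'a::banach \<Rightarrow> 'a"
  assumes T: "0 \<le> T"
    and cont: "\<And>\<phi>. continuous_on {0..T} \<phi> \<Longrightarrow> continuous_on {0..T} (\<lambda>s. F s (\<phi> s))"
    and lip: "\<And>s x y. s \<in> {0..T} \<Longrightarrow> norm (F s x - F s y) \<le> K * norm (x - y)"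
  obtains x where "continuous_on {0..T} x"
    and "\<And>t. t \<in> {0..T} \<Longrightarrow> ((\<lambda>s. F s (x s)) has_integral (x t - x0)) {0..t}"
proof -
  define c where "c = 2 * \<bar>K\<bar> + 1"
  have c: "c > 0" "\<bar>K\<bar> / c \<le> 1/2" by (auto simp: c_def field_simps)
  \<comment> \<open>Time is clamped to \<open>[0, T]\<close>, so that the operator acts on functions on the whole real line.\<close>
  define cl where "cl t = max 0 (min T t)" for t
  have cl: "cl t \<in> {0..T}" for t using T by (auto simp: cl_def)
  have cl_id: "cl t = t" if "t \<in> {0..T}" for t using that by (auto simp: cl_def)
  define I where "I \<psi> t = exp (- (c * t)) *\<^sub>R (x0 + integral {0..t} (\<lambda>s. F s (exp (c * s) *\<^sub>R \<psi> s)))"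
    for \<psi> :: "real \<Rightarrow> 'a" and t
  have cF: "continuous_on {0..T} (\<lambda>s. F s (exp (c * s) *\<^sub>R \<psi> s))"
    if "continuous_on {0..T} \<psi>" for \<psi> :: "real \<Rightarrow> 'a"
    by (rule cont) (intro continuous_intros that)
  have iF: "(\<lambda>s. F s (exp (c * s) *\<^sub>R \<psi> s)) integrable_on {0..t}"
    if "continuous_on {0..T} \<psi>" "t \<in> {0..T}" for \<psi> :: "real \<Rightarrow> 'a" and t
    by (rule integrable_continuous_interval, rule continuous_on_subset[OF cF])
      (use that in auto)
  have cI: "continuous_on {0..T} (I \<psi>)" if "continuous_on {0..T} \<psi>" for \<psi> :: "real \<Rightarrow> 'a"
    unfolding I_def using iF[OF that, of T] T
    by (intro continuous_intros indefinite_integral_continuous_1) auto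
  have bcf: "(\<lambda>t. I \<psi> (cl t)) \<in> bcontfun" if "continuous_on {0..T} \<psi>" for \<psi> :: "real \<Rightarrow> 'a"
  proof -
    have "continuous_on UNIV (\<lambda>t. I \<psi> (cl t))"
      by (rule continuous_on_compose2[OF cI[OF that], of UNIV cl])
        (use cl in \<open>auto simp: cl_def intro!: continuous_intros\<close>)
    moreover have "bounded (I \<psi> ` {0..T})"
      by (intro compact_imp_bounded compact_continuous_image cI that) auto
    then have "bounded (range (\<lambda>t. I \<psi> (cl t)))"
      by (rule bounded_subset) (use cl in auto)
    ultimately show ?thesis by (simp add: bcontfun_def)
  qed
  define P where "P \<psi> = Bcontfun (\<lambda>t. I (apply_bcontfun \<psi>) (cl t))" for \<psi> :: "real \<Rightarrow>\<^sub>C 'a"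
  have P: "apply_bcontfun (P \<psi>) t = I (apply_bcontfun \<psi>) (cl t)" for \<psi> t
    unfolding P_def by (subst Bcontfun_inverse) (auto intro: bcf)
  have "dist (P \<psi>1) (P \<psi>2) \<le> 1/2 * dist \<psi>1 \<psi>2" for \<psi>1 \<psi>2
  proof (rule dist_bound)
    fix t0
    define t where "t = cl t0"
    have t: "t \<in> {0..T}" using cl t_def by auto
    define d where "d = dist \<psi>1 \<psi>2"
    define D where "D s = F s (exp (c * s) *\<^sub>R apply_bcontfun \<psi>1 s) - F s (exp (c * s) *\<^sub>R apply_bcontfun \<psi>2 s)" for s
    have d: "norm (apply_bcontfun \<psi>1 s - apply_bcontfun \<psi>2 s) \<le> d" "0 \<le> d" for s
      unfolding d_def using dist_bounded[of \<psi>1 s \<psi>2] by (auto simp: dist_norm)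
    have "((\<lambda>s. \<bar>K\<bar> * d * exp (c * s)) has_integral (\<bar>K\<bar> * d / c * exp (c * t) - \<bar>K\<bar> * d / c * exp (c * 0))) {0..t}"
      by (rule fundamental_theorem_of_calculus)
        (use t c in \<open>auto intro!: derivative_eq_intros simp: has_real_derivative_iff_has_vector_derivative[symmetric]\<close>)
    then have ei: "(\<lambda>s. \<bar>K\<bar> * d * exp (c * s)) integrable_on {0..t}"
      "integral {0..t} (\<lambda>s. \<bar>K\<bar> * d * exp (c * s)) \<le> \<bar>K\<bar> * d / c * exp (c * t)"
      using c d(2) by (auto simp: has_integral_iff)
    have "norm (integral {0..t} D) \<le> integral {0..t} (\<lambda>s. \<bar>K\<bar> * d * exp (c * s))"
    proof (rule integral_norm_bound_integral)
      show "D integrable_on {0..t}" unfolding D_def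
        by (intro integrable_diff iF t) auto
      fix s assume s: "s \<in> {0..t}"
      have "norm (D s) \<le> K * norm (exp (c * s) *\<^sub>R apply_bcontfun \<psi>1 s - exp (c * s) *\<^sub>R apply_bcontfun \<psi>2 s)"
        unfolding D_def by (rule lip) (use s t in auto)
      also have "\<dots> \<le> \<bar>K\<bar> * norm (exp (c * s) *\<^sub>R apply_bcontfun \<psi>1 s - exp (c * s) *\<^sub>R apply_bcontfun \<psi>2 s)"
        by (intro mult_right_mono) auto
      also have "\<dots> = \<bar>K\<bar> * (exp (c * s) * norm (apply_bcontfun \<psi>1 s - apply_bcontfun \<psi>2 s))"
        by (simp flip: scaleR_diff_right)
      also have "\<dots> \<le> \<bar>K\<bar> * (exp (c * s) * d)"
        by (intro mult_left_mono d) auto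
      finally show "norm (D s) \<le> \<bar>K\<bar> * d * exp (c * s)" by (simp add: mult_ac)
    qed (use ei in auto)
    also have "\<dots> \<le> \<bar>K\<bar> * d / c * exp (c * t)" by (rule ei)
    finally have D: "norm (integral {0..t} D) \<le> \<bar>K\<bar> * d / c * exp (c * t)" .
    have "apply_bcontfun (P \<psi>1) t0 - apply_bcontfun (P \<psi>2) t0 = exp (- (c * t)) *\<^sub>R integral {0..t} D"
      unfolding P I_def D_def t_def[symmetric] by (subst integral_diff) (auto intro!: iF t simp flip: scaleR_diff_right)
    then have "dist (apply_bcontfun (P \<psi>1) t0) (apply_bcontfun (P \<psi>2) t0) = exp (- (c * t)) * norm (integral {0..t} D)"
      by (simp add: dist_norm)
    also have "\<dots> \<le> exp (- (c * t)) * (\<bar>K\<bar> * d / c * exp (c * t))"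
      by (intro mult_left_mono D) auto
    also have "\<dots> = \<bar>K\<bar> / c * d" by (simp add: exp_minus)
    also have "\<dots> \<le> 1/2 * d" by (intro mult_right_mono c d)
    finally show "dist (apply_bcontfun (P \<psi>1) t0) (apply_bcontfun (P \<psi>2) t0) \<le> 1/2 * dist \<psi>1 \<psi>2" by (simp add: d_def)
  qed
  then have "\<exists>!\<psi>. P \<psi> = \<psi>" by (intro banach_fix_type[where c = "1/2"]) auto
  then obtain \<psi> where \<psi>: "P \<psi> = \<psi>" by blast
  define x where "x t = exp (c * t) *\<^sub>R apply_bcontfun \<psi> t" for t
  show ?thesis
  proof
    show "continuous_on {0..T} x" unfolding x_def by (intro continuous_intros continuous_on_apply_bcontfun)
    fix t assume t: "t \<in> {0..T}"
    have "apply_bcontfun \<psi> t = I (apply_bcontfun \<psi>) t" using P[of \<psi> t] \<psi> cl_id[OF t] by simp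
    then have "x t = x0 + integral {0..t} (\<lambda>s. F s (x s))"
      unfolding x_def by (simp add: I_def exp_minus)
    moreover have "(\<lambda>s. F s (x s)) integrable_on {0..t}"
      unfolding x_def by (intro iF t) auto
    ultimately show "((\<lambda>s. F s (x s)) has_integral (x t - x0)) {0..t}"
      by (simp add: has_integral_iff)
  qed
qed

text \<open>
  A field that is Lipschitz only on a ball becomes globally Lipschitz when it is composed with the
  nearest-point projection onto the ball. The solution for the modified field stays inside the ball
  for a short time, and there the two fields agree.
\<close>

lemma local_solution_exists:
  fixes h :: "'a::euclidean_space \<Rightarrow> 'a"
  assumes lip: "K-lipschitz_on (cball x0 1) h"
  obtains T :: real and x :: "real \<Rightarrow> 'a" where "0 < T" "x 0 = x0" "continuous_on {0..T} (\<lambda>s. h (x s))"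
    and "\<And>t. t \<in> {0..T} \<Longrightarrow> ((\<lambda>s. h (x s)) has_integral (x t - x0)) {0..t}"
proof -
  define cp where "cp = closest_point (cball x0 (1::real))"
  have cp: "cp x \<in> cball x0 1" for x unfolding cp_def by (rule closest_point_in_set) auto
  have cp_id: "cp x = x" if "x \<in> cball x0 1" for x
    unfolding cp_def using that by (rule closest_point_self)
  have cp_lip: "dist (cp x) (cp y) \<le> dist x y" for x y
    unfolding cp_def by (rule closest_point_lipschitz) auto
  have ccp: "continuous_on UNIV cp"
    unfolding cp_def by (rule continuous_on_closest_point) auto
  have ch: "continuous_on (cball x0 1) h" using lip by (rule lipschitz_on_continuous_on)
  obtain x :: "real \<Rightarrow> 'a" where x: "continuous_on {0..1} x"
    "\<And>t. t \<in> {0..1} \<Longrightarrow> ((\<lambda>s. h (cp (x s))) has_integral (x t - x0)) {0..t}"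
  proof (rule picard_global[of 1 "\<lambda>_ x. h (cp x)" K x0])
    fix \<phi> :: "real \<Rightarrow> 'a" assume \<phi>: "continuous_on {0..1} \<phi>"
    have "continuous_on {0..1} (\<lambda>s. cp (\<phi> s))"
      by (rule continuous_on_compose2[OF ccp \<phi>]) auto
    then show "continuous_on {0..1} (\<lambda>s. h (cp (\<phi> s)))"
      by (rule continuous_on_compose2[OF ch]) (use cp in auto)
  next
    fix x y :: 'a
    have "dist (h (cp x)) (h (cp y)) \<le> K * dist (cp x) (cp y)"
      using lip cp by (rule lipschitz_onD) (rule cp)
    also have "\<dots> \<le> K * dist x y"
      using cp_lip lipschitz_on_nonneg[OF lip] by (rule mult_left_mono)
    finally show "norm (h (cp x) - h (cp y)) \<le> K * norm (x - y)" by (simp add: dist_norm)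
  qed (simp, blast)
  have x0: "x 0 = x0" using integral_unique[OF x(2)[of 0]] by simp
  obtain d where d: "d > 0" "\<And>t. t \<in> {0..1} \<Longrightarrow> dist t 0 < d \<Longrightarrow> dist (x t) (x 0) < 1"
    using x(1)[unfolded continuous_on_iff, rule_format, of 0 1] by auto
  define T where "T = min 1 (d / 2)"
  have T: "0 < T" "T \<le> 1" "T < d" using d(1) by (auto simp: T_def)
  have id: "cp (x s) = x s" "x s \<in> cball x0 1" if "s \<in> {0..T}" for s
    using d(2)[of s] that T cp_id[of "x s"] by (auto simp: x0 dist_commute dist_real_def)
  show ?thesis
  proof (rule that)
    have "continuous_on {0..T} x" using x(1) T by (auto intro: continuous_on_subset)
    then show "continuous_on {0..T} (\<lambda>s. h (x s))"
      by (rule continuous_on_compose2[OF ch]) (use id in auto)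
    fix t assume t: "t \<in> {0..T}"
    have "((\<lambda>s. h (cp (x s))) has_integral (x t - x0)) {0..t}" using x(2) t T by auto
    then show "((\<lambda>s. h (x s)) has_integral (x t - x0)) {0..t}"
      using has_integral_eq[of "{0..t}" "\<lambda>s. h (cp (x s))" "\<lambda>s. h (x s)"] id t by auto
  qed (use T x0 in auto)
qed

text \<open>
  A control that is merely integrable does not give a field continuous in time. Substituting
  \<open>z = \<zeta> + U B\<close>, where \<open>U\<close> is the indefinite integral of \<open>u\<close>, moves the control into a continuous
  forcing term, and the equation for \<open>\<zeta>\<close> is one that Picard iteration solves.
  The number of coordinates is not known to the type system, so the iteration runs in one Banach space that
  is large enough for any number of them: the bounded continuous functions on the real line.
  The coordinate of index \<open>a\<close> is the value at the natural number encoding \<open>a\<close>, and the basis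
  vector \<open>e a\<close> is the tent function at that number.
\<close>

lemma affine_integral_system_exists:
  fixes A :: "'i::countable \<Rightarrow> 'i \<Rightarrow> real" and u :: "real \<Rightarrow> real"
  assumes fin: "finite S" and T: "0 \<le> T" and u: "u integrable_on {0..T}"
  obtains z where "\<And>t a. t \<in> {0..T} \<Longrightarrow> a \<in> S \<Longrightarrow>
    ((\<lambda>s. (\<Sum>b\<in>S. A a b * z s b) + B a * u s + D a) has_integral (z t a - z0 a)) {0..t}"
proof -
  define U where "U t = integral {0..t} u" for t
  have cU: "continuous_on {0..T} U"
    unfolding U_def by (rule indefinite_integral_continuous_1[OF u])
  have U: "(u has_integral U t) {0..t}" if "t \<in> {0..T}" for t
    unfolding U_def
    by (rule integrable_integral, rule integrable_on_subinterval[OF u]) (use that in auto)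
  define h where "h s a = (\<Sum>b\<in>S. A a b * (B b * U s)) + D a" for s a
  define idx :: "'i \<Rightarrow> real" where "idx a = real (to_nat a)" for a
  define e :: "'i \<Rightarrow> real \<Rightarrow>\<^sub>C real"
    where "e a = Bcontfun (\<lambda>r. max 0 (1 - \<bar>r - idx a\<bar>))" for a
  have e: "apply_bcontfun (e a) r = max 0 (1 - \<bar>r - idx a\<bar>)" for a r
    unfolding e_def
    by (subst Bcontfun_inverse) (auto intro!: bcontfun_normI[of _ 1] continuous_intros)
  have e_idx: "apply_bcontfun (e a) (idx b) = (if a = b then 1 else 0)" for a b
  proof (cases "a = b")
    case False
    then have "to_nat a \<noteq> to_nat b" by simp
    then have "\<bar>int (to_nat b) - int (to_nat a)\<bar> \<ge> 1" by linarith
    then have "\<bar>idx b - idx a\<bar> \<ge> 1" by (simp add: idx_def)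
    with False show ?thesis by (simp add: e)
  qed (simp add: e)
  have norm_e: "norm (e a) \<le> 1" for a
    by (rule norm_bound) (simp add: e)
  have blin: "bounded_linear (\<lambda>Z :: real \<Rightarrow>\<^sub>C real. apply_bcontfun Z k)" for k
  proof (rule bounded_linear_intro[where K = 1])
    show "norm (apply_bcontfun Z k) \<le> norm Z * 1" for Z :: "real \<Rightarrow>\<^sub>C real"
      using norm_bounded[of Z k] by simp
  qed (simp_all add: plus_bcontfun.rep_eq scaleR_bcontfun.rep_eq)
  have ev: "apply_bcontfun (\<Sum>a\<in>S. r a *\<^sub>R e a) (idx a) = r a" if "a \<in> S" for r a
  proof -
    have "apply_bcontfun (\<Sum>a\<in>S. r a *\<^sub>R e a) (idx a) = (\<Sum>b\<in>S. apply_bcontfun (r b *\<^sub>R e b) (idx a))"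
      by (rule linear_sum[OF bounded_linear.linear[OF blin]])
    also have "\<dots> = (\<Sum>b\<in>S. if b = a then r b else 0)"
      by (intro sum.cong) (auto simp: e_idx scaleR_bcontfun.rep_eq)
    also have "\<dots> = r a" using fin that by simp
    finally show ?thesis .
  qed
  define F where "F s Z = (\<Sum>a\<in>S. ((\<Sum>b\<in>S. A a b * apply_bcontfun Z (idx b)) + h s a) *\<^sub>R e a)" for s Z
  define K where "K = (\<Sum>a\<in>S. \<Sum>b\<in>S. \<bar>A a b\<bar>)"
  obtain Z where Z: "\<And>t. t \<in> {0..T} \<Longrightarrow>
      ((\<lambda>s. F s (Z s)) has_integral (Z t - (\<Sum>a\<in>S. z0 a *\<^sub>R e a))) {0..t}"
  proof (rule picard_global[OF T, of F K])
    fix \<phi> :: "real \<Rightarrow> real \<Rightarrow>\<^sub>C real" assume \<phi>: "continuous_on {0..T} \<phi>"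
    show "continuous_on {0..T} (\<lambda>s. F s (\<phi> s))"
      unfolding F_def h_def
      by (intro continuous_intros cU bounded_linear.continuous_on[OF blin] \<phi>)
  next
    fix s and x y :: "real \<Rightarrow>\<^sub>C real"
    have "F s x - F s y = (\<Sum>a\<in>S. (\<Sum>b\<in>S. A a b * apply_bcontfun (x - y) (idx b)) *\<^sub>R e a)"
      unfolding F_def sum_subtractf[symmetric] scaleR_diff_left[symmetric]
      by (intro sum.cong) (simp_all add: minus_bcontfun.rep_eq right_diff_distrib sum_subtractf)
    also have "norm \<dots> \<le> (\<Sum>a\<in>S. (\<Sum>b\<in>S. \<bar>A a b\<bar> * norm (x - y)) * 1)"
    proof (rule sum_norm_le)
      fix a
      have "norm ((\<Sum>b\<in>S. A a b * apply_bcontfun (x - y) (idx b)) *\<^sub>R e a)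
        = \<bar>\<Sum>b\<in>S. A a b * apply_bcontfun (x - y) (idx b)\<bar> * norm (e a)" by simp
      also have "\<dots> \<le> (\<Sum>b\<in>S. \<bar>A a b\<bar> * norm (x - y)) * 1"
        using norm_bounded[of "x - y"]
        by (intro mult_mono norm_e order_trans[OF sum_abs] sum_mono sum_nonneg)
          (auto simp: abs_mult intro!: mult_left_mono)
      finally show "norm ((\<Sum>b\<in>S. A a b * apply_bcontfun (x - y) (idx b)) *\<^sub>R e a) \<le> \<dots>" .
    qed
    also have "\<dots> = K * norm (x - y)" by (simp add: K_def flip: sum_distrib_right)
    finally show "norm (F s x - F s y) \<le> K * norm (x - y)" .
  qed blast
  define z where "z t a = apply_bcontfun (Z t) (idx a) + B a * U t" for t a
  show ?thesis
  proof (rule that[of z])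
    fix t a assume t: "t \<in> {0..T}" and a: "a \<in> S"
    have "((\<lambda>s. (\<Sum>b\<in>S. A a b * apply_bcontfun (Z s) (idx b)) + h s a) has_integral
        (apply_bcontfun (Z t) (idx a) - z0 a)) {0..t}"
      using has_integral_linear[OF Z[OF t] blin[of "idx a"]]
      by (simp add: o_def F_def ev a minus_bcontfun.rep_eq)
    from has_integral_add[OF this has_integral_mult_right[OF U[OF t], of "B a"]]
    show "((\<lambda>s. (\<Sum>b\<in>S. A a b * z s b) + B a * u s + D a) has_integral (z t a - z0 a)) {0..t}"
      by (simp add: z_def h_def algebra_simps sum.distrib)
  qed
qed

text \<open>
  The weight \<open>exp (- c t)\<close> replaces the Gronwall inequality: let \<open>m\<close> be a time at which the weighted norm
  \<open>N\<close> of the solution is maximal; the integral equation at \<open>m\<close> gives \<open>N m \<le> K / c * N m\<close> with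
  \<open>K < c\<close>, so the maximum is zero.
\<close>

lemma homogeneous_linear_solution_zero:
  fixes w :: "real \<Rightarrow> 'i \<Rightarrow> real"
  assumes fin: "finite S"
    and w: "\<And>t a. t \<in> {0..T} \<Longrightarrow> a \<in> S \<Longrightarrow> ((\<lambda>s. \<Sum>b\<in>S. A a b * w s b) has_integral w t a) {0..t}"
    and t: "t \<in> {0..T}" and a: "a \<in> S"
  shows "w t a = 0"
proof -
  have T: "0 \<le> T" using t by auto
  define K where "K = (\<Sum>a\<in>S. \<Sum>b\<in>S. \<bar>A a b\<bar>)"
  have K0: "K \<ge> 0" unfolding K_def by (intro sum_nonneg) auto
  define c where "c = 2 * K + 1"
  have c: "c > 0" "K < c" using K0 by (auto simp: c_def field_simps)
  have cw: "continuous_on {0..T} (\<lambda>t. w t a)" if "a \<in> S" for a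
  proof -
    have "continuous_on {0..T} (\<lambda>t. integral {0..t} (\<lambda>s. \<Sum>b\<in>S. A a b * w s b))"
      by (rule indefinite_integral_continuous_1) (use w[OF _ that, of T] T in auto)
    moreover have "integral {0..t} (\<lambda>s. \<Sum>b\<in>S. A a b * w s b) = w t a" if "t \<in> {0..T}" for t
      using w[OF that \<open>a \<in> S\<close>] by (rule integral_unique)
    ultimately show ?thesis by (rule continuous_on_eq)
  qed
  define N where "N t = exp (- (c * t)) * (\<Sum>b\<in>S. \<bar>w t b\<bar>)" for t
  have "continuous_on {0..T} N" unfolding N_def by (intro continuous_intros cw)
  then obtain m where m: "m \<in> {0..T}" "\<And>t. t \<in> {0..T} \<Longrightarrow> N t \<le> N m"
    using continuous_attains_sup[of "{0..T}" N] T by auto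
  have N0: "N t \<ge> 0" for t unfolding N_def by (intro mult_nonneg_nonneg sum_nonneg) auto
  have wb: "\<bar>w s b\<bar> \<le> exp (c * s) * N m" if "s \<in> {0..T}" "b \<in> S" for s b
  proof -
    have "\<bar>w s b\<bar> \<le> (\<Sum>b\<in>S. \<bar>w s b\<bar>)" using that fin by (intro member_le_sum) auto
    also have "\<dots> = exp (c * s) * N s" by (simp add: N_def exp_minus)
    also have "\<dots> \<le> exp (c * s) * N m" using m(2)[OF that(1)] by simp
    finally show ?thesis .
  qed
  have "\<bar>w m a\<bar> \<le> (\<Sum>b\<in>S. \<bar>A a b\<bar>) * (N m / c * exp (c * m))" if "a \<in> S" for a
  proof -
    define Ka where "Ka = (\<Sum>b\<in>S. \<bar>A a b\<bar>)"
    have Ka: "0 \<le> Ka" unfolding Ka_def by (intro sum_nonneg) auto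
    have "((\<lambda>s. Ka * N m * exp (c * s)) has_integral (Ka * N m / c * exp (c * m) - Ka * N m / c * exp (c * 0))) {0..m}"
      by (rule fundamental_theorem_of_calculus)
        (use m c in \<open>auto intro!: derivative_eq_intros simp: has_real_derivative_iff_has_vector_derivative[symmetric]\<close>)
    then have ei: "(\<lambda>s. Ka * N m * exp (c * s)) integrable_on {0..m}"
      "integral {0..m} (\<lambda>s. Ka * N m * exp (c * s)) \<le> Ka * N m / c * exp (c * m)"
      using c N0 Ka by (auto simp: has_integral_iff)
    have "norm (integral {0..m} (\<lambda>s. \<Sum>b\<in>S. A a b * w s b)) \<le> integral {0..m} (\<lambda>s. Ka * N m * exp (c * s))"
    proof (rule integral_norm_bound_integral)
      show "(\<lambda>s. \<Sum>b\<in>S. A a b * w s b) integrable_on {0..m}" using w[OF m(1) that] by auto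
      fix s assume s: "s \<in> {0..m}"
      have "norm (\<Sum>b\<in>S. A a b * w s b) \<le> (\<Sum>b\<in>S. \<bar>A a b\<bar> * (exp (c * s) * N m))"
        by (rule sum_norm_le) (use s m in \<open>auto simp: abs_mult intro!: mult_left_mono wb\<close>)
      then show "norm (\<Sum>b\<in>S. A a b * w s b) \<le> Ka * N m * exp (c * s)"
        by (simp add: Ka_def mult_ac flip: sum_distrib_left sum_distrib_right)
    qed (use ei in auto)
    also have "\<dots> \<le> Ka * N m / c * exp (c * m)" by (rule ei)
    finally show ?thesis using w[OF m(1) that] by (simp add: has_integral_iff Ka_def)
  qed
  then have "(\<Sum>a\<in>S. \<bar>w m a\<bar>) \<le> (\<Sum>a\<in>S. (\<Sum>b\<in>S. \<bar>A a b\<bar>) * (N m / c * exp (c * m)))"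
    by (rule sum_mono)
  also have "\<dots> = K * (N m / c * exp (c * m))" unfolding K_def by (rule sum_distrib_right[symmetric])
  finally have "exp (- (c * m)) * (\<Sum>a\<in>S. \<bar>w m a\<bar>) \<le> exp (- (c * m)) * (K * (N m / c * exp (c * m)))"
    by (intro mult_left_mono) auto
  then have "N m \<le> exp (- (c * m)) * (K * (N m / c * exp (c * m)))"
    unfolding N_def[symmetric] .
  also have "\<dots> = K / c * N m" by (simp add: exp_minus)
  finally have "N m \<le> K / c * N m" .
  then have "N m * (1 - K / c) \<le> 0" by (simp add: algebra_simps)
  moreover have "1 - K / c > 0" using c by simp
  ultimately have "N m \<le> 0" by (simp add: mult_le_0_iff)
  then show ?thesis using wb[OF t a] by (smt (verit) exp_gt_zero mult_nonneg_nonpos2 mult.commute)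
qed

lemma zero_if_integral_zero:
  fixes d :: "real \<Rightarrow> real"
  assumes T: "0 < T" and cont: "continuous_on {0..T} d"
    and int: "\<And>t. t \<in> {0..T} \<Longrightarrow> (d has_integral 0) {0..t}"
  shows "d 0 = 0"
proof -
  have "((\<lambda>t. integral {0..t} d) has_vector_derivative d 0) (at 0 within {0..T})"
    using cont T by (intro integral_has_vector_derivative) auto
  then have "((\<lambda>_. 0) has_vector_derivative d 0) (at 0 within {0..T})"
    by (rule has_vector_derivative_transform[rotated 2])
      (use T integral_unique[OF int] in auto)
  then show ?thesis
    using T vector_derivative_unique_within_closed_interval[of 0 T 0 "\<lambda>_. 0" "d 0" 0] by auto
qed

section \<open>Smooth functions\<close>

lemma k_smooth_const: "k_smooth k (\<lambda>_. c)"
proof (induction k arbitrary: c)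
  case (Suc k)
  have "frechet_derivative (\<lambda>_::'a. c) (at x) = (\<lambda>_. 0)" for x
    by (rule frechet_derivative_at[symmetric]) simp
  then show ?case using Suc by simp
qed simp

lemma k_smooth_bounded_linear: "bounded_linear l \<Longrightarrow> k_smooth k l"
proof (cases k)
  case (Suc k')
  assume l: "bounded_linear l"
  then have "frechet_derivative l (at x) = l" for x
    by (metis frechet_derivative_at bounded_linear_imp_has_derivative)
  with l Suc show ?thesis by (simp add: k_smooth_const bounded_linear_imp_differentiable)
qed (simp add: linear_continuous_on)

lemma k_smooth_add:
  "k_smooth k p \<Longrightarrow> k_smooth k q \<Longrightarrow> k_smooth k (\<lambda>x. p x + q x)"
proof (induction k arbitrary: p q)
  case 0
  then show ?case by (auto intro: continuous_on_add)
next
  case (Suc k)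
  have "((\<lambda>x. p x + q x) has_derivative
      (\<lambda>v. frechet_derivative p (at x) v + frechet_derivative q (at x) v)) (at x)" for x
    using Suc.prems by (intro has_derivative_add) (auto simp: frechet_derivative_works[symmetric])
  from frechet_derivative_at[OF this]
  have "frechet_derivative (\<lambda>x. p x + q x) (at x) v =
      frechet_derivative p (at x) v + frechet_derivative q (at x) v" for x v
    by metis
  with Suc show ?case by (auto intro: differentiable_add)
qed

lemma k_smooth_cmult:
  fixes p :: "'a::euclidean_space \<Rightarrow> real"
  shows "k_smooth k p \<Longrightarrow> k_smooth k (\<lambda>x. c * p x)"
proof (induction k arbitrary: p)
  case 0
  then show ?case by (auto intro: continuous_intros)
next
  case (Suc k)
  have "((\<lambda>x. c * p x) has_derivative (\<lambda>v. c * frechet_derivative p (at x) v)) (at x)" for x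
    using Suc.prems
    by (intro has_derivative_mult_right) (auto simp: frechet_derivative_works[symmetric])
  from frechet_derivative_at[OF this]
  have "frechet_derivative (\<lambda>x. c * p x) (at x) v = c * frechet_derivative p (at x) v" for x v
    by metis
  with Suc show ?case by auto
qed

lemma smooth_const: "smooth (\<lambda>_. k)"
  and smooth_bounded_linear: "bounded_linear l \<Longrightarrow> smooth l"
  and smooth_add: "smooth p \<Longrightarrow> smooth q \<Longrightarrow> smooth (\<lambda>x. p x + q x)"
  and smooth_cmult: "smooth r \<Longrightarrow> smooth (\<lambda>x. (c::real) * r x)"
  by (auto simp: smooth_def k_smooth_const k_smooth_bounded_linear k_smooth_add k_smooth_cmult)

lemma smooth_sum: "(\<And>a. a \<in> S \<Longrightarrow> smooth (p a)) \<Longrightarrow> smooth (\<lambda>x. \<Sum>a\<in>S. p a x)"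
  by (induction S rule: infinite_finite_induct) (auto intro: smooth_add smooth_const)

lemma smooth_differentiable: "smooth p \<Longrightarrow> p differentiable (at x)"
  and smooth_continuous_derivative:
    "smooth p \<Longrightarrow> continuous_on UNIV (\<lambda>x. frechet_derivative p (at x) v)"
  using k_smooth.simps(2)[of 0 p] by (auto simp: smooth_def)

lemma smooth_has_derivative:
  "smooth p \<Longrightarrow> (p has_derivative frechet_derivative p (at x)) (at x)"
  using smooth_differentiable frechet_derivative_works by blast

text \<open>
  The differential is continuous only in the sense that each directional derivative is. Bounding the
  derivatives along the finitely many basis vectors on the compact ball bounds its operator norm.
\<close>

lemma lipschitz_on_cball_if_C1:
  fixes f :: "'a::euclidean_space \<Rightarrow> 'b::real_normed_vector"
  assumes diff: "\<And>x. f differentiable (at x)"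
    and cont: "\<And>v. continuous_on UNIV (\<lambda>x. frechet_derivative f (at x) v)"
  obtains K where "K-lipschitz_on (cball a r) f"
proof -
  have "\<exists>M. \<forall>x\<in>cball a r. norm (frechet_derivative f (at x) i) \<le> M" for i
  proof -
    have "compact ((\<lambda>x. frechet_derivative f (at x) i) ` cball a r)"
      by (intro compact_continuous_image continuous_on_subset[OF cont]) auto
    from compact_imp_bounded[OF this] show ?thesis
      unfolding bounded_iff by auto
  qed
  then obtain M where M: "\<And>i x. x \<in> cball a r \<Longrightarrow> norm (frechet_derivative f (at x) i) \<le> M i"
    by metis
  define K where "K = (\<Sum>i\<in>Basis. \<bar>M i\<bar>)"
  have der: "(f has_derivative frechet_derivative f (at x)) (at x)" for x
    using diff frechet_derivative_works by blast
  have "onorm (frechet_derivative f (at x)) \<le> K" if x: "x \<in> cball a r" for x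
  proof (rule onorm_le)
    fix v
    have lin: "linear (frechet_derivative f (at x))" using der has_derivative_linear by blast
    have "frechet_derivative f (at x) v = frechet_derivative f (at x) (\<Sum>i\<in>Basis. (v \<bullet> i) *\<^sub>R i)"
      by (simp add: euclidean_representation)
    also have "\<dots> = (\<Sum>i\<in>Basis. (v \<bullet> i) *\<^sub>R frechet_derivative f (at x) i)"
      using lin by (simp add: linear_sum linear_cmul)
    also have "norm \<dots> \<le> (\<Sum>i\<in>Basis. norm v * \<bar>M i\<bar>)"
    proof (rule sum_norm_le)
      fix i :: 'a assume "i \<in> Basis"
      then have "\<bar>v \<bullet> i\<bar> \<le> norm v" by (rule Basis_le_norm)
      moreover have "norm (frechet_derivative f (at x) i) \<le> \<bar>M i\<bar>" using M[OF x, of i] by linarith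
      ultimately show "norm ((v \<bullet> i) *\<^sub>R frechet_derivative f (at x) i) \<le> norm v * \<bar>M i\<bar>"
        by (auto intro!: mult_mono)
    qed
    finally show "norm (frechet_derivative f (at x) v) \<le> K * norm v"
      by (simp add: K_def mult.commute[of _ "norm v"] sum_distrib_left)
  qed
  then have "norm (f x - f y) \<le> K * norm (x - y)" if "x \<in> cball a r" "y \<in> cball a r" for x y
    using that by (intro differentiable_bound[OF convex_cball has_derivative_at_withinI[OF der]])
  then have "K-lipschitz_on (cball a r) f"
    by (intro lipschitz_onI) (auto simp: dist_norm K_def intro!: sum_nonneg)
  then show ?thesis by (rule that)
qed

lemma smooth_lipschitz_on_cball:
  fixes h :: "'a::euclidean_space \<Rightarrow> 'b::real_normed_vector"
  assumes "smooth h"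
  obtains K where "K-lipschitz_on (cball a r) h"
  using lipschitz_on_cball_if_C1[OF smooth_differentiable smooth_continuous_derivative] assms
  by blast

section \<open>Solutions of the affine system\<close>

lemma finite_coords [simp]: "finite (coords m :: ('n::finite + nat) set)"
  by (simp add: coords_def)

lemma sum_coords:
  "(\<Sum>b\<in>coords m. h b) = (\<Sum>i\<in>UNIV. h (Inl i)) + (\<Sum>j<m. h (Inr j :: 'n::finite + nat))"
  unfolding coords_def by (simp add: sum.Plus)

lemma Inl_in_coords [simp]: "Inl i \<in> coords m"
  and Inr_in_coords [simp]: "Inr j \<in> coords m \<longleftrightarrow> j < m"
  by (auto simp: coords_def)

lemma control_const: "control (\<lambda>_. c)"
  by (auto simp: control_def intro: absolutely_integrable_continuous_real)

lemma affine_solution_exists: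
  assumes "control u" "0 \<le> T"
  shows "\<exists>z. affine_solution L u z0 T z"
proof -
  have "u integrable_on {0..T}"
    using assms by (auto simp: control_def absolutely_integrable_on_def)
  then obtain z where "\<And>t a. t \<in> {0..T} \<Longrightarrow> a \<in> coords (obs_dim L) \<Longrightarrow>
      ((\<lambda>s. (\<Sum>b\<in>coords (obs_dim L). sys_A L a b * z s b) + sys_B L a * u s + sys_D L a)
        has_integral (z t a - z0 a)) {0..t}"
    using affine_integral_system_exists[OF finite_coords assms(2), of u "obs_dim L" "sys_A L" "sys_B L" "sys_D L" z0]
    by blast
  then show ?thesis unfolding affine_solution_def by blast
qed

lemma affine_solution_initial:
  assumes "affine_solution L u z0 T z" "0 \<le> T" "a \<in> coords (obs_dim L)"
  shows "z 0 a = z0 a"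
proof -
  have "((\<lambda>s. (\<Sum>b\<in>coords (obs_dim L). sys_A L a b * z s b) + sys_B L a * u s + sys_D L a)
        has_integral (z 0 a - z0 a)) {0..0}"
    using assms unfolding affine_solution_def by (meson atLeastAtMost_iff order_refl)
  from integral_unique[OF this] show ?thesis by simp
qed

lemma affine_solution_continuous:
  assumes z: "affine_solution L u z0 T z" and T: "0 \<le> T" and a: "a \<in> coords (obs_dim L)"
  shows "continuous_on {0..T} (\<lambda>t. z t a)"
proof -
  define h where
    "h s = (\<Sum>b\<in>coords (obs_dim L). sys_A L a b * z s b) + sys_B L a * u s + sys_D L a" for s
  have h: "(h has_integral (z t a - z0 a)) {0..t}" if "t \<in> {0..T}" for t
    using z a that by (auto simp: affine_solution_def h_def[abs_def])
  have "continuous_on {0..T} (\<lambda>t. z0 a + integral {0..t} h)"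
    using h[of T] T by (intro continuous_intros indefinite_integral_continuous_1) auto
  moreover have "z0 a + integral {0..t} h = z t a" if "t \<in> {0..T}" for t
    using integral_unique[OF h[OF that]] by simp
  ultimately show ?thesis by (rule continuous_on_eq)
qed

lemma affine_solution_unique:
  assumes z: "affine_solution L u z0 T z" and z': "affine_solution L u z0 T z'"
    and t: "t \<in> {0..T}" and a: "a \<in> coords (obs_dim L)"
  shows "z t a = z' t a"
proof -
  have "z t a - z' t a = 0"
  proof (rule homogeneous_linear_solution_zero[OF _ _ t a, where A = "sys_A L" and w = "\<lambda>t a. z t a - z' t a"])
    fix t :: real and a :: "'a + nat"
    assume "t \<in> {0..T}" "a \<in> coords (obs_dim L)"
    with z z' have "((\<lambda>s. ((\<Sum>b\<in>coords (obs_dim L). sys_A L a b * z s b) + sys_B L a * u s + sys_D L a) -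
          ((\<Sum>b\<in>coords (obs_dim L). sys_A L a b * z' s b) + sys_B L a * u s + sys_D L a))
        has_integral (z t a - z0 a) - (z' t a - z0 a)) {0..t}"
      unfolding affine_solution_def by (intro has_integral_diff) auto
    then show "((\<lambda>s. \<Sum>b\<in>coords (obs_dim L). sys_A L a b * (z s b - z' s b))
        has_integral (z t a - z' t a)) {0..t}"
      by (simp add: right_diff_distrib sum_subtractf)
  qed simp
  then show ?thesis by simp
qed

section \<open>The vector fields of a super-linearizable system\<close>

definition G_col :: "'n::finite slin \<Rightarrow> nat \<Rightarrow> real^'n" where
  "G_col L j = (\<chi> i. G_matrix L i j)"

text \<open>
  Under the constant control \<open>c\<close> the first \<open>n\<close> coordinates of the affine solution coincide with the
  solution of the control system on some interval \<open>[0, T]\<close>. So the two right-hand sides, which are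
  continuous in time, have the same integral over each \<open>[0, t]\<close>, and therefore the same value at time
  \<open>0\<close>, where the lifted state is \<open>(x, p(x))\<close>.
\<close>

lemma super_linearization_vector_fields:
  fixes f g :: "real^'n \<Rightarrow> real^'n"
  assumes f: "smooth f" and g: "smooth g" and L: "super_linearization f g L"
  shows "f x $ i + c * g x $ i =
    (\<Sum>b\<in>coords (obs_dim L). sys_A L (Inl i) b * lift_state L x b) + sys_B L (Inl i) * c + sys_D L (Inl i)"
proof -
  obtain K1 K2 where "K1-lipschitz_on (cball x 1) f" "K2-lipschitz_on (cball x 1) g"
    by (meson smooth_lipschitz_on_cball f g)
  then have "(K1 + \<bar>c\<bar> * K2)-lipschitz_on (cball x 1) (\<lambda>y. f y + c *\<^sub>R g y)"
    by (intro lipschitz_on_add lipschitz_on_cmult)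
  then obtain T and X :: "real \<Rightarrow> real^'n" where T: "0 < T" and X: "X 0 = x" "continuous_on {0..T} (\<lambda>s. f (X s) + c *\<^sub>R g (X s))"
    "\<And>t. t \<in> {0..T} \<Longrightarrow> ((\<lambda>s. f (X s) + c *\<^sub>R g (X s)) has_integral (X t - x)) {0..t}"
    by (rule local_solution_exists) blast
  have sol: "control_solution f g (\<lambda>_. c) x T X"
    using X(3) by (simp add: control_solution_def)
  obtain z where z: "affine_solution L (\<lambda>_. c) (lift_state L x) T z"
    using affine_solution_exists[OF control_const less_imp_le[OF T]] by blast
  have eq: "proj (z t) = X t" if "t \<in> {0..T}" for t
    using L control_const sol z T that unfolding super_linearization_def by (meson less_imp_le)
  define d where "d s = (f (X s) + c *\<^sub>R g (X s)) $ i -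
     ((\<Sum>b\<in>coords (obs_dim L). sys_A L (Inl i) b * z s b) + sys_B L (Inl i) * c + sys_D L (Inl i))" for s
  have "d 0 = 0"
  proof (rule zero_if_integral_zero[OF T])
    show "continuous_on {0..T} d" unfolding d_def
      using T z by (intro continuous_intros X affine_solution_continuous) auto
    fix t assume t: "t \<in> {0..T}"
    have 1: "((\<lambda>s. (f (X s) + c *\<^sub>R g (X s)) $ i) has_integral (X t - x) $ i) {0..t}"
      using has_integral_linear[OF X(3)[OF t] bounded_linear_vec_nth[of i]] by (simp add: o_def)
    have 2: "((\<lambda>s. (\<Sum>b\<in>coords (obs_dim L). sys_A L (Inl i) b * z s b) + sys_B L (Inl i) * c + sys_D L (Inl i))
        has_integral (z t (Inl i) - lift_state L x (Inl i))) {0..t}"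
      using z t unfolding affine_solution_def by simp
    have "z t (Inl i) - lift_state L x (Inl i) = (X t - x) $ i"
      using eq[OF t, symmetric] by (simp add: proj_def lift_state_def)
    with has_integral_diff[OF 1 2] show "(d has_integral 0) {0..t}"
      unfolding d_def[abs_def] by simp
  qed
  moreover have "(\<Sum>b\<in>coords (obs_dim L). sys_A L (Inl i) b * z 0 b) =
      (\<Sum>b\<in>coords (obs_dim L). sys_A L (Inl i) b * lift_state L x b)"
    using T by (intro sum.cong) (simp_all add: affine_solution_initial[OF z])
  ultimately show ?thesis by (simp add: d_def X)
qed

lemma super_linearization_drift:
  fixes f g :: "real^'n \<Rightarrow> real^'n"
  assumes "smooth f" "smooth g" "super_linearization f g L"
  shows "f x $ i = (\<Sum>i'\<in>UNIV. sys_A L (Inl i) (Inl i') * x $ i') +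
    (\<Sum>j<obs_dim L. obs L j x *\<^sub>R G_col L j) $ i + sys_D L (Inl i)"
  using super_linearization_vector_fields[OF assms, of x i 0]
  by (simp add: sum_coords lift_state_def G_col_def G_matrix_def mult.commute)

lemma super_linearization_control_field:
  fixes f g :: "real^'n \<Rightarrow> real^'n"
  assumes "smooth f" "smooth g" "super_linearization f g L"
  shows "g x $ i = sys_B L (Inl i)"
  using super_linearization_vector_fields[OF assms, of x i 0]
    super_linearization_vector_fields[OF assms, of x i 1]
  by simp

text \<open>
  This is the quantity that all super-linearizations of a system share; their \<open>G\<close>-matrices and
  observables enter the drift only through it and through an affine map.
\<close>

definition nonlinear_part :: "(real^'n \<Rightarrow> real^'n) \<Rightarrow> real^'n \<Rightarrow> real^'n" where
  "nonlinear_part f x = f x - f 0 - frechet_derivative f (at 0) x"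

text \<open>
  The affine terms of the drift drop out of the difference with the first-order Taylor polynomial at
  \<open>0\<close>, and what remains of each observable is its own nonlinear part.
\<close>

lemma nonlinear_part_eq:
  fixes f g :: "real^'n \<Rightarrow> real^'n"
  assumes f: "smooth f" and g: "smooth g" and L: "super_linearization f g L"
  shows "nonlinear_part f x =
    (\<Sum>j<obs_dim L. (obs L j x - obs L j 0 - frechet_derivative (obs L j) (at 0) x) *\<^sub>R G_col L j)"
proof -
  define M where "M = (\<chi> i i'. sys_A L (Inl i) (Inl i'))"
  have fx: "f = (\<lambda>x. M *v x + (\<Sum>j<obs_dim L. obs L j x *\<^sub>R G_col L j) + (\<chi> i. sys_D L (Inl i)))"
    by (intro ext) (simp add: vec_eq_iff super_linearization_drift[OF assms]
        matrix_vector_mult_def M_def)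
  have lin: "((*v) M has_derivative (*v) M) (at 0)"
    by (rule bounded_linear_imp_has_derivative) (rule matrix_vector_mul_bounded_linear)
  have obs: "((\<lambda>x. \<Sum>j<obs_dim L. obs L j x *\<^sub>R G_col L j) has_derivative
      (\<lambda>v. \<Sum>j<obs_dim L. frechet_derivative (obs L j) (at 0) v *\<^sub>R G_col L j)) (at 0)"
    by (rule has_derivative_sum, rule has_derivative_scaleR_left, rule smooth_has_derivative)
      (use L in \<open>simp add: super_linearization_def\<close>)
  have "(f has_derivative (\<lambda>v. M *v v +
      (\<Sum>j<obs_dim L. frechet_derivative (obs L j) (at 0) v *\<^sub>R G_col L j) + 0)) (at 0)"
    unfolding fx by (rule has_derivative_add[OF has_derivative_add[OF lin obs] has_derivative_const])
  from frechet_derivative_at[OF this]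
  have "frechet_derivative f (at 0) x = M *v x +
      (\<Sum>j<obs_dim L. frechet_derivative (obs L j) (at 0) x *\<^sub>R G_col L j)"
    by (simp add: fun_eq_iff)
  then show ?thesis
    unfolding nonlinear_part_def
    by (simp add: fun_cong[OF fx] scaleR_diff_left sum_subtractf)
qed

definition centered :: "'n::finite slin \<Rightarrow> bool" where
  "centered L \<longleftrightarrow> (\<forall>j<obs_dim L. obs L j 0 = 0 \<and> (obs L j has_derivative (\<lambda>_. 0)) (at 0))"

lemma nonlinear_part_centered:
  fixes f g :: "real^'n \<Rightarrow> real^'n"
  assumes "smooth f" "smooth g" "super_linearization f g L" "centered L"
  shows "nonlinear_part f x = (\<Sum>j<obs_dim L. obs L j x *\<^sub>R G_col L j)"
proof -
  have "frechet_derivative (obs L j) (at 0) = (\<lambda>_. 0)" "obs L j 0 = 0" if "j < obs_dim L" for j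
    using that assms(4) frechet_derivative_at[of "obs L j" "\<lambda>_. 0" 0] by (auto simp: centered_def)
  then show ?thesis by (simp add: nonlinear_part_eq[OF assms(1-3)])
qed

section \<open>Number of visible observables and rank of the G-matrix\<close>

lemma super_linearization_span:
  fixes f g :: "real^'n \<Rightarrow> real^'n"
  assumes "smooth f" "smooth g" "super_linearization f g L"
  shows "range (nonlinear_part f) \<subseteq> span (G_col L ` {..<obs_dim L})"
proof clarify
  fix x show "nonlinear_part f x \<in> span (G_col L ` {..<obs_dim L})"
    unfolding nonlinear_part_eq[OF assms] by (intro span_sum span_scale span_base imageI)
qed

lemma G_col_eq_0_iff: "G_col L j = 0 \<longleftrightarrow> (\<forall>i. G_matrix L i j = 0)"
  by (simp add: G_col_def vec_eq_iff)

lemma span_G_col_visible: "span (G_col L ` visible L) = span (G_col L ` {..<obs_dim L})"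
proof -
  have "span (G_col L ` {..<obs_dim L}) \<subseteq> span (G_col L ` visible L)"
  proof (rule span_minimal)
    show "G_col L ` {..<obs_dim L} \<subseteq> span (G_col L ` visible L)"
    proof (clarsimp)
      fix j assume "j < obs_dim L"
      then show "G_col L j \<in> span (G_col L ` visible L)"
        using span_zero[of "G_col L ` visible L"]
        by (cases "j \<in> visible L") (auto simp: visible_def intro: span_base
            simp flip: G_col_eq_0_iff)
    qed
  qed simp
  moreover have "span (G_col L ` visible L) \<subseteq> span (G_col L ` {..<obs_dim L})"
    by (rule span_mono) (auto simp: visible_def)
  ultimately show ?thesis by simp
qed

lemma finite_visible: "finite (visible L)"
  by (rule finite_subset[of _ "{..<obs_dim L}"]) (auto simp: visible_def)

text \<open>
  The range of the nonlinear part lies in the span of as many vectors as there are visible observables.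
\<close>

lemma visible_lower_bound:
  fixes f g :: "real^'n \<Rightarrow> real^'n"
  assumes "smooth f" "smooth g" "super_linearization f g L"
  shows "dim (range (nonlinear_part f)) \<le> card (visible L)"
proof -
  have "dim (range (nonlinear_part f)) \<le> card (G_col L ` visible L)"
    using super_linearization_span[OF assms] finite_visible
    by (intro dim_le_card) (auto simp: span_G_col_visible)
  also have "\<dots> \<le> card (visible L)" by (rule card_image_le) (rule finite_visible)
  finally show ?thesis .
qed

text \<open>
  The range of the nonlinear part always lies in the column space of \<open>G\<close>. Conversely, if \<open>v\<close>
  is orthogonal to that range, then \<open>\<Sum>\<^sub>j (v \<bullet> G\<^sub>j) p\<^sub>j\<close> vanishes identically; by independence of
  the visible observables \<open>v\<close> is orthogonal to their columns, and the other columns are zero. So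
  the column space is no larger than the span of the range.
\<close>

lemma G_rank_reduced:
  fixes f g :: "real^'n \<Rightarrow> real^'n"
  assumes f: "smooth f" and g: "smooth g" and L: "super_linearization f g L"
    and red: "reduced_visible_form L"
  shows "G_rank L = dim (range (nonlinear_part f))"
proof -
  have "centered L" using red by (simp add: reduced_visible_form_def centered_def)
  note N = nonlinear_part_centered[OF f g L this]
  define V where "V = span (range (nonlinear_part f))"
  have "G_col L j \<in> V" if j: "j < obs_dim L" for j
  proof -
    obtain y v where yv: "y \<in> V" "\<And>w. w \<in> V \<Longrightarrow> orthogonal v w" "G_col L j = y + v"
      using orthogonal_subspace_decomp_exists[of "range (nonlinear_part f)" "G_col L j"]
      unfolding V_def by blast
    have perp: "(\<Sum>l<obs_dim L. (v \<bullet> G_col L l) * obs L l x) = 0" for x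
    proof -
      have "v \<bullet> nonlinear_part f x = 0"
        using yv(2)[of "nonlinear_part f x"] by (auto simp: V_def orthogonal_def span_base)
      then show ?thesis by (simp add: N inner_sum_right mult.commute)
    qed
    have "(\<Sum>l\<in>visible L. (v \<bullet> G_col L l) * obs L l x) = (\<Sum>l<obs_dim L. (v \<bullet> G_col L l) * obs L l x)" for x
      by (rule sum.mono_neutral_left) (auto simp: visible_def G_col_eq_0_iff[symmetric])
    then have "\<forall>x. (\<Sum>l\<in>visible L. (v \<bullet> G_col L l) * obs L l x) = 0"
      by (simp add: perp)
    moreover from red have "(\<forall>x. (\<Sum>l\<in>visible L. (v \<bullet> G_col L l) * obs L l x) = 0) \<longrightarrow>
        (\<forall>l\<in>visible L. v \<bullet> G_col L l = 0)"
      unfolding reduced_visible_form_def by (elim conjE) (erule spec)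
    ultimately have "\<forall>l\<in>visible L. v \<bullet> G_col L l = 0" by simp
    then have "v \<bullet> G_col L j = 0"
      using j by (cases "j \<in> visible L") (auto simp: visible_def G_col_eq_0_iff[symmetric])
    moreover have "v \<bullet> y = 0" using yv(1,2) by (simp add: orthogonal_def)
    ultimately have "v = 0" using yv(3) by (simp add: inner_add_right)
    with yv show ?thesis by simp
  qed
  then have "span (G_col L ` {..<obs_dim L}) \<subseteq> V"
    unfolding V_def by (intro span_minimal) auto
  moreover have "V \<subseteq> span (G_col L ` {..<obs_dim L})"
    unfolding V_def by (intro span_minimal super_linearization_span[OF f g L]) simp
  ultimately have "dim (span (G_col L ` {..<obs_dim L})) = dim V" by simp
  then show ?thesis by (simp add: V_def G_rank_def G_col_def)
qed

section \<open>Passing from one super-linearization to another\<close>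

text \<open>
  To see that \<open>L'\<close> is a super-linearization, it is enough to produce one solution of \<open>L'\<close> from each
  solution of \<open>L\<close> that follows the control system: the latter exists for every integrable
  control, and the solution of \<open>L'\<close> with a given initial state is unique.
\<close>

lemma super_linearization_transfer:
  assumes L: "super_linearization f g L" and sm: "\<And>j. j < obs_dim L' \<Longrightarrow> smooth (obs L' j)"
    and map: "\<And>x0 u T x z. control_solution f g u x0 T x \<Longrightarrow>
      affine_solution L u (lift_state L x0) T z \<Longrightarrow> (\<And>t. t \<in> {0..T} \<Longrightarrow> proj (z t) = x t) \<Longrightarrow>
      \<exists>z'. affine_solution L' u (lift_state L' x0) T z' \<and> (\<forall>t i. z' t (Inl i) = z t (Inl i))"
  shows "super_linearization f g L'"
  unfolding super_linearization_def
proof (intro conjI allI impI ballI)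
  fix x0 u T x w t
  assume A: "control u \<and> 0 \<le> T \<and> control_solution f g u x0 T x \<and>
    affine_solution L' u (lift_state L' x0) T w" and t: "t \<in> {0..T}"
  obtain z where z: "affine_solution L u (lift_state L x0) T z"
    using affine_solution_exists A by blast
  have pz: "proj (z t) = x t" if "t \<in> {0..T}" for t
    using L A z that unfolding super_linearization_def by blast
  obtain z' where z': "affine_solution L' u (lift_state L' x0) T z'" "\<And>t i. z' t (Inl i) = z t (Inl i)"
    using map[of u x0 T x z] A z pz by blast
  have "w t (Inl i) = z t (Inl i)" for i
    using affine_solution_unique[of L' u "lift_state L' x0" T w z' t "Inl i"] A z' t by simp
  then show "proj (w t) = x t"
    unfolding pz[OF t, symmetric] by (simp add: proj_def)
qed (use sm in auto)

section \<open>Removing the affine part of the observables\<close>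

definition obs_jac :: "'n::finite slin \<Rightarrow> nat \<Rightarrow> 'n \<Rightarrow> real" where
  "obs_jac L j i = frechet_derivative (obs L j) (at 0) (axis i 1)"

lemma obs_derivative_eq_jac:
  assumes "smooth (obs L j)"
  shows "frechet_derivative (obs L j) (at 0) x = (\<Sum>i\<in>UNIV. obs_jac L j i * x $ i)"
proof -
  have lin: "linear (frechet_derivative (obs L j) (at 0))"
    using smooth_has_derivative[OF assms] has_derivative_linear by blast
  have "frechet_derivative (obs L j) (at 0) x =
      frechet_derivative (obs L j) (at 0) (\<Sum>i\<in>UNIV. x $ i *\<^sub>R axis i 1)"
    using basis_expansion[of x] by (simp add: scalar_mult_eq_scaleR)
  then show ?thesis
    using lin by (simp add: linear_sum linear_cmul obs_jac_def mult.commute)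
qed

text \<open>
  The linear map \<open>(x, y) \<mapsto> (x, y - P x)\<close>, where \<open>P\<close> is the Jacobian of the observables at \<open>0\<close>. It is applied
  both to states and to the right-hand side of the affine system, whose rows transform in the same way.
\<close>

definition shear :: "'n::finite slin \<Rightarrow> ('n + nat \<Rightarrow> real) \<Rightarrow> 'n + nat \<Rightarrow> real" where
  "shear L h a = (case a of Inl i \<Rightarrow> h (Inl i)
     | Inr j \<Rightarrow> h (Inr j) - (\<Sum>i\<in>UNIV. obs_jac L j i * h (Inl i)))"

text \<open>
  The affine system rewritten in the coordinates \<open>(x, y - P x - p(0))\<close>: the argument of each \<open>shear\<close>
  comes from the old right-hand side by writing \<open>y + P x + p(0)\<close> for \<open>y\<close>, and the row operation
  \<open>shear\<close> turns it into the rates of change of the new coordinates.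
  The block \<open>G\<close> stays the same.
\<close>

definition center_obs :: "'n::finite slin \<Rightarrow> 'n slin" where
  "center_obs L = \<lparr>
     obs_dim = obs_dim L,
     sys_A = (\<lambda>a c. shear L (\<lambda>a'. sys_A L a' c +
       (case c of Inl i \<Rightarrow> \<Sum>j<obs_dim L. sys_A L a' (Inr j) * obs_jac L j i | Inr _ \<Rightarrow> 0)) a),
     sys_B = shear L (sys_B L),
     sys_D = shear L (\<lambda>a. sys_D L a + (\<Sum>j<obs_dim L. sys_A L a (Inr j) * obs L j 0)),
     obs = (\<lambda>j x. obs L j x - obs L j 0 - frechet_derivative (obs L j) (at 0) x)\<rparr>"

lemma center_obs_simps [simp]:
  "obs_dim (center_obs L) = obs_dim L"
  "obs (center_obs L) j x = obs L j x - obs L j 0 - frechet_derivative (obs L j) (at 0) x"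
  by (simp_all add: center_obs_def)

lemma shear_add: "shear L (\<lambda>a. h a + k a) a = shear L h a + shear L k a"
  by (cases a) (simp_all add: shear_def algebra_simps sum.distrib)

lemma shear_diff: "shear L (\<lambda>a. h a - k a) a = shear L h a - shear L k a"
  by (cases a) (simp_all add: shear_def algebra_simps sum.distrib sum_subtractf)

lemma shear_mult: "shear L (\<lambda>a. h a * c) a = shear L h a * c"
  by (cases a) (simp_all add: shear_def algebra_simps sum_distrib_left sum_distrib_right)

lemma shear_sum: "finite S \<Longrightarrow> shear L (\<lambda>a. \<Sum>c\<in>S. h c a) a = (\<Sum>c\<in>S. shear L (h c) a)"
proof (induction S rule: finite_induct)
  case empty
  then show ?case by (cases a) (simp_all add: shear_def)
qed (simp add: shear_add)

lemma has_integral_shear: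
  assumes h: "\<And>a. a \<in> coords m \<Longrightarrow> ((\<lambda>s. h s a) has_integral I a) S" and a: "a \<in> coords m"
  shows "((\<lambda>s. shear L (h s) a) has_integral shear L I a) S"
proof (cases a)
  case (Inl i)
  then show ?thesis using h[of a] a by (simp add: shear_def)
next
  case (Inr j)
  then show ?thesis
    using a by (auto simp: shear_def intro!: has_integral_diff has_integral_sum
        has_integral_mult_right h)
qed

lemma center_obs_super_linearization:
  assumes L: "super_linearization f g L"
  shows "super_linearization f g (center_obs L)"
proof (rule super_linearization_transfer[OF L])
  have sm: "smooth (obs L j)" if "j < obs_dim L" for j
    using L that by (simp add: super_linearization_def)
  show "smooth (obs (center_obs L) j)" if "j < obs_dim (center_obs L)" for j
  proof -
    have j: "smooth (obs L j)" using that sm by simp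
    have "smooth (\<lambda>x. obs L j x + (- obs L j 0 + (- 1) * frechet_derivative (obs L j) (at 0) x))"
      by (intro smooth_add smooth_const smooth_cmult smooth_bounded_linear j
          has_derivative_bounded_linear[OF smooth_has_derivative[OF j]])
    then show ?thesis by (simp add: center_obs_def algebra_simps)
  qed
  fix u x0 T and x :: "real \<Rightarrow> real^'a" and z
  assume z: "affine_solution L u (lift_state L x0) T z"
  define c :: "'a + nat \<Rightarrow> real" where "c = case_sum (\<lambda>_. 0) (\<lambda>j. obs L j 0)"
  define z' where "z' t a = shear L (z t) a - c a" for t a
  have row: "(\<Sum>b\<in>coords (obs_dim L). (sys_A L a b +
      (case b of Inl i \<Rightarrow> \<Sum>j<obs_dim L. sys_A L a (Inr j) * obs_jac L j i | Inr _ \<Rightarrow> 0)) * z' s b)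
      + (\<Sum>j<obs_dim L. sys_A L a (Inr j) * obs L j 0)
      = (\<Sum>b\<in>coords (obs_dim L). sys_A L a b * z s b)" for a s
  proof -
    have "(\<Sum>i\<in>UNIV. (\<Sum>j<obs_dim L. sys_A L a (Inr j) * obs_jac L j i) * z s (Inl i)) =
        (\<Sum>j<obs_dim L. sys_A L a (Inr j) * (\<Sum>i\<in>UNIV. obs_jac L j i * z s (Inl i)))"
      by (simp add: sum_distrib_left sum_distrib_right mult.assoc sum.swap[of _ UNIV])
    then show ?thesis
      by (simp add: sum_coords z'_def c_def shear_def distrib_right right_diff_distrib
          sum.distrib sum_subtractf)
  qed
  have "affine_solution (center_obs L) u (lift_state (center_obs L) x0) T z'"
    unfolding affine_solution_def center_obs_simps
  proof (intro ballI)
    fix t and a :: "'a + nat" assume t: "t \<in> {0..T}" and a: "a \<in> coords (obs_dim L)"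
    have "lift_state (center_obs L) x0 a = shear L (lift_state L x0) a - c a"
      using a by (cases a) (auto simp: lift_state_def shear_def c_def obs_derivative_eq_jac[OF sm])
    then have init: "shear L (\<lambda>a. z t a - lift_state L x0 a) a = z' t a - lift_state (center_obs L) x0 a"
      by (simp add: z'_def shear_diff)
    have "shear L (\<lambda>a. (\<Sum>b\<in>coords (obs_dim L). sys_A L a b * z s b) + sys_B L a * u s + sys_D L a) a
      = (\<Sum>b\<in>coords (obs_dim L). sys_A (center_obs L) a b * z' s b) + sys_B (center_obs L) a * u s
        + sys_D (center_obs L) a" for s
      unfolding row[symmetric]
      by (simp add: center_obs_def shear_add shear_sum shear_mult)
    moreover have "((\<lambda>s. shear L (\<lambda>a. (\<Sum>b\<in>coords (obs_dim L). sys_A L a b * z s b) + sys_B L a * u s + sys_D L a) a)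
      has_integral shear L (\<lambda>a. z t a - lift_state L x0 a) a) {0..t}"
      using z t by (intro has_integral_shear[OF _ a]) (auto simp: affine_solution_def)
    ultimately show "((\<lambda>s. (\<Sum>b\<in>coords (obs_dim L). sys_A (center_obs L) a b * z' s b) +
        sys_B (center_obs L) a * u s + sys_D (center_obs L) a)
      has_integral z' t a - lift_state (center_obs L) x0 a) {0..t}"
      by (simp add: init)
  qed
  then show "\<exists>z'. affine_solution (center_obs L) u (lift_state (center_obs L) x0) T z' \<and>
      (\<forall>t i. z' t (Inl i) = z t (Inl i))"
    by (intro exI[of _ z']) (simp add: z'_def shear_def c_def)
qed

lemma centered_center_obs:
  assumes L: "super_linearization f g L"
  shows "centered (center_obs L)"
  unfolding centered_def
proof (intro allI impI conjI)
  fix j assume "j < obs_dim (center_obs L)"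
  then have "smooth (obs L j)" using L by (simp add: super_linearization_def)
  note der = smooth_has_derivative[OF this, of 0]
  have bl: "bounded_linear (frechet_derivative (obs L j) (at 0))"
    using der by (rule has_derivative_bounded_linear)
  show "obs (center_obs L) j 0 = 0"
    using bl by (simp add: linear_0 bounded_linear.linear)
  have "((\<lambda>x. obs L j x - obs L j 0 - frechet_derivative (obs L j) (at 0) x) has_derivative
     (\<lambda>v. frechet_derivative (obs L j) (at 0) v - 0 - frechet_derivative (obs L j) (at 0) v)) (at 0)"
    by (rule has_derivative_diff[OF has_derivative_diff[OF der has_derivative_const]
          bounded_linear_imp_has_derivative[OF bl]])
  then show "(obs (center_obs L) j has_derivative (\<lambda>_. 0)) (at 0)"
    by (simp add: center_obs_def)
qed

section \<open>Adjoining the coordinates of the nonlinear part\<close>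

text \<open>
  Appends to \<open>(x, y)\<close> the coordinates \<open>b\<^sub>k \<bullet> G y\<close>, at the indices from \<open>obs_dim L\<close> on.
\<close>

definition adjoin :: "'n::finite slin \<Rightarrow> (nat \<Rightarrow> real^'n) \<Rightarrow> ('n + nat \<Rightarrow> real) \<Rightarrow> 'n + nat \<Rightarrow> real" where
  "adjoin L b h a = (case a of Inl i \<Rightarrow> h (Inl i)
     | Inr j \<Rightarrow> if j < obs_dim L then h (Inr j)
         else \<Sum>l<obs_dim L. (b (j - obs_dim L) \<bullet> G_col L l) * h (Inr l))"

text \<open>
  The old observables \<open>y\<close> keep their dynamics, and the new ones \<open>w\<^sub>k = b\<^sub>k \<bullet> G y\<close> inherit theirs from
  \<open>y\<close>. In the equation for \<open>x\<close> the term \<open>G y\<close> is replaced by \<open>\<Sum>\<^sub>k w\<^sub>k b\<^sub>k\<close>, which for orthonormal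
  \<open>b\<^sub>k\<close> is the projection of \<open>G y\<close> onto their span. So the new columns of the \<open>G\<close>-matrix are the \<open>b\<^sub>k\<close>,
  and the old ones are set to zero.
\<close>

definition adjoin_obs :: "'n::finite slin \<Rightarrow> (nat \<Rightarrow> real^'n) \<Rightarrow> nat \<Rightarrow> 'n slin" where
  "adjoin_obs L b r = \<lparr>
     obs_dim = obs_dim L + r,
     sys_A = (\<lambda>a c. case a of
         Inl i \<Rightarrow> (case c of Inl i' \<Rightarrow> sys_A L a c
           | Inr j \<Rightarrow> if j < obs_dim L then 0 else b (j - obs_dim L) $ i)
       | Inr _ \<Rightarrow> if c \<in> coords (obs_dim L) then adjoin L b (\<lambda>a. sys_A L a c) a else 0),
     sys_B = adjoin L b (sys_B L),
     sys_D = adjoin L b (sys_D L),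
     obs = (\<lambda>j x. adjoin L b (lift_state L x) (Inr j))\<rparr>"

lemma adjoin_add: "adjoin L b (\<lambda>a. h a + k a) a = adjoin L b h a + adjoin L b k a"
  by (cases a) (simp_all add: adjoin_def algebra_simps sum.distrib)

lemma adjoin_mult: "adjoin L b (\<lambda>a. h a * c) a = adjoin L b h a * c"
  by (cases a) (simp_all add: adjoin_def algebra_simps sum_distrib_left sum_distrib_right)

lemma adjoin_sum: "finite S \<Longrightarrow> adjoin L b (\<lambda>a. \<Sum>c\<in>S. h c a) a = (\<Sum>c\<in>S. adjoin L b (h c) a)"
proof (induction S rule: finite_induct)
  case empty
  then show ?case by (cases a) (simp_all add: adjoin_def)
qed (simp add: adjoin_add)

lemma sum_lessThan_add: "(\<Sum>j<m + r. h j) = (\<Sum>j<m. h j) + (\<Sum>k<r. h (m + k))"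
  for h :: "nat \<Rightarrow> 'a::comm_monoid_add"
  by (induction r) (simp_all add: add.assoc)

text \<open>
  Only the equation for \<open>x\<close> has changed, from \<open>G y\<close> to \<open>Pr (G y)\<close>. Along a solution that follows
  the control system, comparison of the two equations for \<open>x\<close> shows that \<open>G y - G p(x)\<close> has
  integral zero over each \<open>[0, t]\<close>. The values \<open>G p(x)\<close> are fixed by \<open>Pr\<close>, so
  \<open>Pr (G y) - G y\<close> also has integral zero, and the integral equation for \<open>x\<close> is unaffected.
\<close>

lemma adjoin_obs_super_linearization:
  fixes f g :: "real^'n \<Rightarrow> real^'n"
  assumes f: "smooth f" and g: "smooth g" and L: "super_linearization f g L"
    and proj_id: "\<And>x. (\<Sum>k<r. (b k \<bullet> (\<Sum>l<obs_dim L. obs L l x *\<^sub>R G_col L l)) *\<^sub>R b k)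
      = (\<Sum>l<obs_dim L. obs L l x *\<^sub>R G_col L l)"
  shows "super_linearization f g (adjoin_obs L b r)"
proof (rule super_linearization_transfer[OF L])
  have sm: "smooth (obs L j)" if "j < obs_dim L" for j
    using L that by (simp add: super_linearization_def)
  show "smooth (obs (adjoin_obs L b r) j)" if "j < obs_dim (adjoin_obs L b r)" for j
    by (cases "j < obs_dim L")
      (auto simp: adjoin_obs_def adjoin_def lift_state_def intro!: sm smooth_sum smooth_cmult)
  fix u x0 T and x :: "real \<Rightarrow> real^'n" and z
  assume x: "control_solution f g u x0 T x" and z: "affine_solution L u (lift_state L x0) T z"
    and xz: "\<And>t. t \<in> {0..T} \<Longrightarrow> proj (z t) = x t"
  define z' where "z' t = adjoin L b (z t)" for t
  define row where "row s a = (\<Sum>c\<in>coords (obs_dim L). sys_A L a c * z s c) + sys_B L a * u s + sys_D L a"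
    for s and a :: "'n + nat"
  define Y where "Y s = (\<Sum>l<obs_dim L. z s (Inr l) *\<^sub>R G_col L l)" for s
  define w where "w x = (\<Sum>l<obs_dim L. obs L l x *\<^sub>R G_col L l)" for x
  define Pr where "Pr v = (\<Sum>k<r. (b k \<bullet> v) *\<^sub>R b k)" for v :: "real^'n"
  have Pr: "bounded_linear Pr" unfolding Pr_def[abs_def]
    by (intro bounded_linear_sum bounded_linear_scaleR_left[THEN bounded_linear_compose]
        bounded_linear_inner_right)
  have Pr_w: "Pr (w x) = w x" for x unfolding Pr_def w_def by (rule proj_id)
  have row: "((\<lambda>s. row s a) has_integral (z t a - lift_state L x0 a)) {0..t}"
    if "t \<in> {0..T}" "a \<in> coords (obs_dim L)" for t a
    using z that by (simp add: affine_solution_def row_def)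
  \<comment> \<open>In components, \<open>row\<close> is \<open>A x + G y + u B\<^sub>1 + D\<^sub>1\<close>, whereas \<open>f x + u g x\<close> is \<open>A x + G p(x) + u B\<^sub>1 + D\<^sub>1\<close>.\<close>
  have defect: "((\<lambda>s. Y s - w (x s)) has_integral 0) {0..t}" if t: "t \<in> {0..T}" for t
  proof -
    have "((\<lambda>s. (Y s - w (x s)) $ i) has_integral 0) {0..t}" for i
    proof -
      have eq: "(Y s - w (x s)) $ i = row s (Inl i) - (f (x s) + u s *\<^sub>R g (x s)) $ i"
        if s: "s \<in> {0..t}" for s
      proof -
        have xs: "x s $ i' = z s (Inl i')" for i'
          using xz[of s, symmetric] s t by (simp add: proj_def)
        have "row s (Inl i) = (\<Sum>i'\<in>UNIV. sys_A L (Inl i) (Inl i') * z s (Inl i')) + Y s $ i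
            + sys_B L (Inl i) * u s + sys_D L (Inl i)"
          by (simp add: row_def sum_coords Y_def G_col_def G_matrix_def mult.commute)
        then show ?thesis
          by (simp add: super_linearization_drift[OF f g L]
              super_linearization_control_field[OF f g L] xs w_def mult.commute)
      qed
      have "((\<lambda>s. f (x s) + u s *\<^sub>R g (x s)) has_integral (x t - x0)) {0..t}"
        using x t by (simp add: control_solution_def)
      from has_integral_linear[OF this bounded_linear_vec_nth[of i]]
      have "((\<lambda>s. (f (x s) + u s *\<^sub>R g (x s)) $ i) has_integral (x t - x0) $ i) {0..t}"
        by (simp add: o_def)
      from has_integral_diff[OF row[OF t, of "Inl i"] this] xz[OF t, symmetric]
      have "((\<lambda>s. row s (Inl i) - (f (x s) + u s *\<^sub>R g (x s)) $ i) has_integral 0) {0..t}"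
        by (simp add: lift_state_def proj_def)
      then show ?thesis by (subst has_integral_cong[OF eq])
    qed
    then show ?thesis
      unfolding has_integral_componentwise_iff[of _ 0] by (auto simp: Basis_vec_def inner_axis)
  qed
  have "((\<lambda>s. Pr (Y s) - Y s) has_integral 0) {0..t}" if "t \<in> {0..T}" for t
    using has_integral_diff[OF has_integral_linear[OF defect[OF that] Pr] defect[OF that]]
    by (simp add: o_def linear_diff[OF bounded_linear.linear[OF Pr]] Pr_w
        linear_0[OF bounded_linear.linear[OF Pr]])
  from has_integral_linear[OF this bounded_linear_vec_nth]
  have corr: "((\<lambda>s. (Pr (Y s) - Y s) $ i) has_integral 0) {0..t}" if "t \<in> {0..T}" for t i
    using that by (simp add: o_def)
  have "affine_solution (adjoin_obs L b r) u (lift_state (adjoin_obs L b r) x0) T z'"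
    unfolding affine_solution_def
  proof (intro ballI)
    fix t and a :: "'n + nat" assume t: "t \<in> {0..T}" and a: "a \<in> coords (obs_dim (adjoin_obs L b r))"
    have init: "lift_state (adjoin_obs L b r) x0 = adjoin L b (lift_state L x0)"
      by (rule ext) (simp add: lift_state_def adjoin_obs_def adjoin_def split: sum.split)
    show "((\<lambda>s. (\<Sum>c\<in>coords (obs_dim (adjoin_obs L b r)). sys_A (adjoin_obs L b r) a c * z' s c) +
        sys_B (adjoin_obs L b r) a * u s + sys_D (adjoin_obs L b r) a)
      has_integral z' t a - lift_state (adjoin_obs L b r) x0 a) {0..t}"
    proof (cases a)
      case (Inl i)
      have PrY: "Pr (Y s) $ i = (\<Sum>k<r. b k $ i * (\<Sum>l<obs_dim L. (b k \<bullet> G_col L l) * z s (Inr l)))" for s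
        by (simp add: Pr_def Y_def inner_sum_right mult.commute)
      have Y_nth: "Y s $ i = (\<Sum>l<obs_dim L. sys_A L (Inl i) (Inr l) * z s (Inr l))" for s
        by (simp add: Y_def G_col_def G_matrix_def mult.commute)
      have "(\<Sum>c\<in>coords (obs_dim (adjoin_obs L b r)). sys_A (adjoin_obs L b r) a c * z' s c) +
        sys_B (adjoin_obs L b r) a * u s + sys_D (adjoin_obs L b r) a = row s a + (Pr (Y s) - Y s) $ i" for s
        by (simp add: Inl PrY Y_nth row_def adjoin_obs_def sum_coords sum_lessThan_add z'_def adjoin_def)
      with has_integral_add[OF row[OF t, of a] corr[OF t, of i]] Inl
      show ?thesis by (simp add: init z'_def adjoin_def)
    next
      case (Inr j)
      have "(\<Sum>c\<in>coords (obs_dim (adjoin_obs L b r)). sys_A (adjoin_obs L b r) a c * z' s c) +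
        sys_B (adjoin_obs L b r) a * u s + sys_D (adjoin_obs L b r) a = adjoin L b (row s) a" for s
      proof -
        have "(\<Sum>c\<in>coords (obs_dim L + r). (if c \<in> coords (obs_dim L) then adjoin L b (\<lambda>a. sys_A L a c) (Inr j) else 0) * z' s c)
          = (\<Sum>c\<in>coords (obs_dim L). adjoin L b (\<lambda>a. sys_A L a c) (Inr j) * z s c)"
          by (simp add: sum_coords sum_lessThan_add z'_def adjoin_def)
        then show ?thesis
          by (simp add: Inr adjoin_obs_def row_def[abs_def] adjoin_add adjoin_sum adjoin_mult)
      qed
      moreover have "((\<lambda>s. adjoin L b (row s) a) has_integral
          adjoin L b (\<lambda>a. z t a - lift_state L x0 a) a) {0..t}"
        using t by (auto simp: Inr adjoin_def intro!: has_integral_sum has_integral_mult_right row)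
      moreover have "adjoin L b (\<lambda>a. z t a - lift_state L x0 a) a = z' t a - lift_state (adjoin_obs L b r) x0 a"
        by (simp add: Inr init z'_def adjoin_def right_diff_distrib sum_subtractf)
      ultimately show ?thesis by simp
    qed
  qed
  then show "\<exists>z'. affine_solution (adjoin_obs L b r) u (lift_state (adjoin_obs L b r) x0) T z' \<and>
      (\<forall>t i. z' t (Inl i) = z t (Inl i))"
    by (intro exI[of _ z']) (simp add: z'_def adjoin_def)
qed

text \<open>
  The new observables are the coordinates \<open>b\<^sub>k \<bullet> w x\<close> of \<open>w x = G p(x)\<close>. A relation between them is a
  combination of the \<open>b\<^sub>k\<close> orthogonal to the range of \<open>w\<close>, hence to the \<open>b\<^sub>k\<close> themselves, which
  makes all its coefficients zero.
\<close>

lemma adjoin_obs_reduced: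
  fixes f g :: "real^'n \<Rightarrow> real^'n"
  assumes cen: "centered L"
    and b: "\<And>k k'. k < r \<Longrightarrow> k' < r \<Longrightarrow> b k \<bullet> b k' = (if k = k' then 1 else 0)"
    and spans: "\<And>k. k < r \<Longrightarrow> b k \<in> span (range (\<lambda>x. \<Sum>l<obs_dim L. obs L l x *\<^sub>R G_col L l))"
  shows "reduced_visible_form (adjoin_obs L b r)" and "card (visible (adjoin_obs L b r)) = r"
proof -
  define w where "w x = (\<Sum>l<obs_dim L. obs L l x *\<^sub>R G_col L l)" for x
  have b_nz: "\<exists>i. b k $ i \<noteq> 0" if "k < r" for k
  proof -
    have "b k \<noteq> 0" using b[OF that that] by auto
    then show ?thesis by (simp add: vec_eq_iff)
  qed
  have "j \<in> visible (adjoin_obs L b r) \<longleftrightarrow> j \<in> (\<lambda>k. obs_dim L + k) ` {..<r}" for j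
  proof (cases "j < obs_dim L")
    case False
    then obtain k where "j = obs_dim L + k" by (metis le_Suc_ex not_less)
    then show ?thesis using b_nz by (auto simp: visible_def G_matrix_def adjoin_obs_def)
  qed (auto simp: visible_def G_matrix_def adjoin_obs_def)
  then have vis: "visible (adjoin_obs L b r) = (\<lambda>k. obs_dim L + k) ` {..<r}" by blast
  then show "card (visible (adjoin_obs L b r)) = r" by (simp add: card_image)
  have obs_new: "obs (adjoin_obs L b r) (obs_dim L + k) x = b k \<bullet> w x" for k x
    by (simp add: adjoin_obs_def adjoin_def lift_state_def w_def inner_sum_right mult.commute)
  have cen': "obs (adjoin_obs L b r) j 0 = 0 \<and> (obs (adjoin_obs L b r) j has_derivative (\<lambda>_. 0)) (at 0)" for j
  proof (cases "j < obs_dim L")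
    case True
    with cen show ?thesis by (simp add: adjoin_obs_def adjoin_def lift_state_def centered_def)
  next
    case False
    have "((\<lambda>x. \<Sum>l<obs_dim L. (b (j - obs_dim L) \<bullet> G_col L l) * obs L l x) has_derivative
       (\<lambda>_. \<Sum>l<obs_dim L. (b (j - obs_dim L) \<bullet> G_col L l) * 0)) (at 0)"
      by (rule has_derivative_sum, rule has_derivative_mult_right)
        (use cen in \<open>auto simp: centered_def\<close>)
    with False cen show ?thesis
      by (simp add: adjoin_obs_def adjoin_def lift_state_def centered_def)
  qed
  have indep: "c (obs_dim L + k) = 0"
    if c: "\<And>x. (\<Sum>j\<in>visible (adjoin_obs L b r). c j * obs (adjoin_obs L b r) j x) = 0" and k: "k < r"
    for c :: "nat \<Rightarrow> real" and k
  proof -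
    define v where "v = (\<Sum>k<r. c (obs_dim L + k) *\<^sub>R b k)"
    have "v \<bullet> w x = 0" for x
      using c[of x] by (simp add: vis sum.reindex obs_new v_def inner_sum_left)
    then have "orthogonal v y" if "y \<in> span (range w)" for y
      using that orthogonal_to_span[of y "range w" v] by (auto simp: orthogonal_def)
    then have "v \<bullet> b k = 0" using spans[OF k] by (simp add: w_def orthogonal_def)
    moreover have "v \<bullet> b k = (\<Sum>k'<r. if k' = k then c (obs_dim L + k') else 0)"
      unfolding v_def inner_sum_left by (intro sum.cong) (simp_all add: b k)
    ultimately show ?thesis using k by simp
  qed
  show "reduced_visible_form (adjoin_obs L b r)"
    unfolding reduced_visible_form_def using cen' indep by (auto simp: vis)
qed

section \<open>Reduced visible form and the least number of visible observables\<close>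

lemma minimal_reduced_super_linearization:
  fixes f g :: "real^'n \<Rightarrow> real^'n"
  assumes f: "smooth f" and g: "smooth g" and L0: "super_linearization f g L0"
  obtains L where "super_linearization f g L" "reduced_visible_form L"
    "card (visible L) = dim (range (nonlinear_part f))"
proof -
  define L1 where "L1 = center_obs L0"
  have L1: "super_linearization f g L1" and cen: "centered L1"
    unfolding L1_def using center_obs_super_linearization centered_center_obs L0 by blast+
  note N = nonlinear_part_centered[OF f g L1 cen]
  define V where "V = span (range (nonlinear_part f))"
  obtain B where B: "B \<subseteq> V" "pairwise orthogonal B" "\<And>x. x \<in> B \<Longrightarrow> norm x = 1"
    "independent B" "card B = dim V" "span B = V"
    using orthonormal_basis_subspace[of V] unfolding V_def by (metis subspace_span)
  define r where "r = dim (range (nonlinear_part f))"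
  have "finite B" using B(4) independent_bound by blast
  then obtain b where b: "bij_betw b {..<r} B"
    using ex_bij_betw_nat_finite[of B] B(5) by (auto simp: r_def V_def atLeast0LessThan)
  have bB: "b k \<in> B" if "k < r" for k using b that by (auto simp: bij_betw_def)
  have orth: "b k \<bullet> b k' = (if k = k' then 1 else 0)" if "k < r" "k' < r" for k k'
  proof (cases "k = k'")
    case True
    then show ?thesis using B(3)[OF bB[OF that(1)]] by (simp add: dot_square_norm)
  next
    case False
    then have "b k \<noteq> b k'" using b that by (auto simp: bij_betw_def inj_on_def)
    then show ?thesis using False B(2) bB that by (auto simp: pairwise_def orthogonal_def)
  qed
  have proj: "(\<Sum>k<r. (b k \<bullet> v) *\<^sub>R b k) = v" if "v \<in> V" for v
  proof -
    have "(\<Sum>k<r. (b k \<bullet> v) *\<^sub>R b k) = (\<Sum>a\<in>B. (a \<bullet> v) *\<^sub>R a)"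
      by (rule sum.reindex_bij_betw[OF b])
    also have "\<dots> = v"
      using orthonormal_basis_expand[OF B(2,3), of v] that B(6) \<open>finite B\<close>
      by (simp add: inner_commute)
    finally show ?thesis .
  qed
  show ?thesis
  proof (rule that)
    show "super_linearization f g (adjoin_obs L1 b r)"
      by (rule adjoin_obs_super_linearization[OF f g L1])
        (unfold N[symmetric], rule proj, simp add: V_def span_base)
    have "b k \<in> span (range (\<lambda>x. \<Sum>l<obs_dim L1. obs L1 l x *\<^sub>R G_col L1 l))" if "k < r" for k
      using bB[OF that] B(1) by (auto simp: V_def N[abs_def])
    from adjoin_obs_reduced[OF cen orth this]
    show "reduced_visible_form (adjoin_obs L1 b r)"
      "card (visible (adjoin_obs L1 b r)) = dim (range (nonlinear_part f))"
      by (simp_all add: r_def)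
  qed
qed

theorem theorem3:
  fixes f g :: "real^'n \<Rightarrow> real^'n"
  assumes "smooth f" and "smooth g"
    and "\<exists>L. super_linearization f g L"
  shows "(\<exists>L. super_linearization f g L \<and> reduced_visible_form L) \<and>
    (\<forall>L. super_linearization f g L \<and> reduced_visible_form L \<longrightarrow>
      (LEAST k. \<exists>L'. super_linearization f g L' \<and> card (visible L') = k) = G_rank L)"
proof -
  obtain L where L: "super_linearization f g L" "reduced_visible_form L"
    "card (visible L) = dim (range (nonlinear_part f))"
    using assms minimal_reduced_super_linearization by metis
  have "(LEAST k. \<exists>L'. super_linearization f g L' \<and> card (visible L') = k) =
      dim (range (nonlinear_part f))"
    using L visible_lower_bound[OF assms(1,2)] by (intro Least_equality) auto
  then show ?thesis using L G_rank_reduced[OF assms(1,2)] by metis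
qed

end
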